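(* Let $X$ be an infinite-dimensional separable complex Banach space and let $T\in\mathcal{B}(X)$ be a quasinilpotent operator. Then the following are equivalent: (1) $T$ has an invariant subspace. (2) There exists a rank one operator $F\in\mathcal{B}(X)$ such that for every $\alpha\in\mathbb{C}$, $T+\alpha F$ is quasinilpotent. (3) There exist a rank one operator $F\in\mathcal{B}(X)$ and $\alpha\in\mathbb{C}$ with $\alpha\neq 0$ and $\alpha\neq 1$ such that both $T+F$ and $T+\alpha F$ are quasinilpotent.
   Context: $\mathcal{B}(X)$ denotes the algebra of bounded linear operators on $X$. An operator $S\in\mathcal{B}(X)$ is called quasinilpotent if its spectrum is $\sigma(S)=\{0\}$. "Invariant subspace" of $T$ means a non-trivial closed invariant subspace: a closed linear subspace $Y\subseteq X$ with $Y\neq\{0\}$, $Y\neq X$ and $T(Y)\subseteq Y$. A rank one operator is a bounded linear operator whose range has dimension exactly one. *)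

theory Defs
  imports "HOL-Analysis.Analysis"
begin

section \<open>Complex Banach spaces\<close>

text \<open>
  A complex normed space is a real normed space with a compatible complex scalar multiplication;
  norm, metric and topology are those of the underlying real normed space.
\<close>

class complex_normed_vector = real_normed_vector +
  fixes scaleC :: "complex \<Rightarrow> 'a \<Rightarrow> 'a"  (infixr "*\<^sub>C" 75)
  assumes scaleC_add_right: "c *\<^sub>C (x + y) = c *\<^sub>C x + c *\<^sub>C y"
    and scaleC_add_left: "(c + d) *\<^sub>C x = c *\<^sub>C x + d *\<^sub>C x"
    and scaleC_scaleC: "c *\<^sub>C d *\<^sub>C x = (c * d) *\<^sub>C x"
    and scaleC_of_real: "complex_of_real r *\<^sub>C x = r *\<^sub>R x"
    and norm_scaleC: "norm (c *\<^sub>C x) = cmod c * norm x"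

class complex_banach = complex_normed_vector + banach

interpretation complex_vector:
  vector_space "scaleC :: complex \<Rightarrow> 'a \<Rightarrow> 'a::complex_normed_vector"
proof
  show "1 *\<^sub>C x = x" for x :: 'a
    using scaleC_of_real[of 1 x] by simp
qed (simp_all add: scaleC_add_right scaleC_add_left scaleC_scaleC)

definition infinite_dimensional :: "'a::complex_normed_vector itself \<Rightarrow> bool" where
  "infinite_dimensional _ \<longleftrightarrow>
    \<not> (\<exists>B :: 'a set. finite B \<and> complex_vector.span B = UNIV)"


section \<open>Bounded operators, spectrum, quasinilpotence\<close>

text \<open>
  Members of \<open>B(X)\<close> are represented as plain functions satisfying \<open>bounded_clinear\<close>.
\<close>

definition bounded_clinear ::
    "('a::complex_normed_vector \<Rightarrow> 'b::complex_normed_vector) \<Rightarrow> bool" where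
  "bounded_clinear S \<longleftrightarrow>
    Vector_Spaces.linear scaleC scaleC S \<and> (\<exists>K. \<forall>x. norm (S x) \<le> norm x * K)"

definition invertible_op :: "('a::complex_normed_vector \<Rightarrow> 'a) \<Rightarrow> bool" where
  "invertible_op S \<longleftrightarrow>
    bounded_clinear S \<and> (\<exists>R. bounded_clinear R \<and> R \<circ> S = id \<and> S \<circ> R = id)"

definition op_spectrum :: "('a::complex_normed_vector \<Rightarrow> 'a) \<Rightarrow> complex set" where
  "op_spectrum S = {z. \<not> invertible_op (\<lambda>x. z *\<^sub>C x - S x)}"

definition quasinilpotent :: "('a::complex_normed_vector \<Rightarrow> 'a) \<Rightarrow> bool" where
  "quasinilpotent S \<longleftrightarrow> bounded_clinear S \<and> op_spectrum S = {0}"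

definition rank_one :: "('a::complex_normed_vector \<Rightarrow> 'b::complex_normed_vector) \<Rightarrow> bool" where
  "rank_one F \<longleftrightarrow> bounded_clinear F \<and> complex_vector.dim (range F) = 1"

definition invariant_subspace ::
    "('a::complex_normed_vector \<Rightarrow> 'a) \<Rightarrow> 'a set \<Rightarrow> bool" where
  "invariant_subspace T Y \<longleftrightarrow>
    complex_vector.subspace Y \<and> closed Y \<and> Y \<noteq> {0} \<and> Y \<noteq> UNIV \<and> T ` Y \<subseteq> Y"

end

theory Submission
  imports Defs "HOL-Complex_Analysis.Great_Picard"
begin

text \<open>
  Write \<open>F = y \<otimes> f\<close> and \<open>A w = (I - wT)\<inverse>\<close>, which is entire in \<open>w\<close> because \<open>T\<close> is quasinilpotent.
  For \<open>w \<noteq> 0\<close> the point \<open>1/w\<close> lies outside the spectrum of \<open>T + \<beta>F\<close> iff \<open>\<beta> w f (A w y) \<noteq> 1\<close>. Hence if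
  \<open>T + F\<close> and \<open>T + \<alpha>F\<close> are quasinilpotent, the entire function \<open>w \<mapsto> w f (A w y)\<close> omits the two values
  \<open>1\<close> and \<open>1/\<alpha>\<close>, so by Picard's little theorem it is constant, hence zero. Then \<open>f\<close> vanishes on the
  orbit of \<open>y\<close>, and the vectors whose orbit lies in the kernel of \<open>f\<close> form an invariant subspace.
  Conversely, given an invariant subspace \<open>Y\<close>, take \<open>y\<close> in \<open>Y\<close> and a functional \<open>f\<close> vanishing on \<open>Y\<close>:
  since \<open>A w\<close> leaves \<open>Y\<close> invariant, \<open>f (A w y) = 0\<close> for all \<open>w\<close>.
\<close>

section \<open>Sublinear functionals and the Hahn--Banach theorem\<close>

text \<open>Homogeneity is asked only as an inequality for \<open>t \<ge> 0\<close>, the form that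
  is easy to check for infima; \<open>sublinear_scaleR\<close> recovers equality.\<close>

definition sublinear :: "('a::real_vector \<Rightarrow> real) \<Rightarrow> bool" where
  "sublinear p \<longleftrightarrow> (\<forall>x y. p (x + y) \<le> p x + p y) \<and> (\<forall>t x. 0 \<le> t \<longrightarrow> p (t *\<^sub>R x) \<le> t * p x)"

lemma sublinearI:
  assumes "\<And>x y. p (x + y) \<le> p x + p y" and "\<And>t x. 0 \<le> t \<Longrightarrow> p (t *\<^sub>R x) \<le> t * p x"
  shows "sublinear p"
  using assms by (auto simp: sublinear_def)

lemma sublinear_add: "sublinear p \<Longrightarrow> p (x + y) \<le> p x + p y"
  by (auto simp: sublinear_def)

lemma sublinear_zero:
  assumes "sublinear p"
  shows "p 0 = 0"
proof -
  have "p (0 *\<^sub>R 0) \<le> 0 * p 0"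
    using assms unfolding sublinear_def by blast
  moreover have "p (0 + 0) \<le> p 0 + p 0"
    using assms by (rule sublinear_add)
  ultimately show ?thesis by simp
qed

lemma sublinear_scaleR:
  assumes p: "sublinear p" and "0 \<le> t"
  shows "p (t *\<^sub>R x) = t * p x"
proof (cases "t = 0")
  case True
  then show ?thesis by (simp add: sublinear_zero[OF p])
next
  case False
  then have t: "t > 0" using assms by simp
  have "p (inverse t *\<^sub>R t *\<^sub>R x) \<le> inverse t * p (t *\<^sub>R x)"
    using p t unfolding sublinear_def by (meson inverse_nonnegative_iff_nonnegative less_imp_le)
  then have "t * p x \<le> p (t *\<^sub>R x)"
    using t by (simp add: field_simps)
  moreover have "p (t *\<^sub>R x) \<le> t * p x"
    using assms by (auto simp: sublinear_def)
  ultimately show ?thesis by simp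
qed

lemma sublinear_minus: "sublinear p \<Longrightarrow> - p (- x) \<le> p x"
  using sublinear_add[of p x "- x"] by (simp add: sublinear_zero)

text \<open>The witness is the infimum over \<open>t \<ge> 0\<close> of
  \<open>p (x + t *\<^sub>R a) - t * p a\<close>. The parameter \<open>t = 0\<close> gives
  \<open>q \<le> p\<close>, and \<open>t = 1\<close> gives the bound by the shift.\<close>

lemma sublinear_shift:
  assumes p: "sublinear p"
  obtains q where "sublinear q" "q \<le> p" "\<And>x. q x \<le> p (x + a) - p a"
proof
  define g where "g x t = p (x + t *\<^sub>R a) - t * p a" for x t
  define q where "q x = (INF t\<in>{0..}. g x t)" for x
  \<comment> \<open>Since \<open>t * p a = p (t *\<^sub>R a)\<close>, splitting
    \<open>t *\<^sub>R a\<close> as \<open>(x + t *\<^sub>R a) + (- x)\<close> bounds the infimum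
    from below.\<close>
  have "- p (- x) \<le> g x t" if "0 \<le> t" for x t
    using sublinear_add[OF p, of "x + t *\<^sub>R a" "- x"] that by (simp add: g_def sublinear_scaleR[OF p])
  then have bdd: "bdd_below (g x ` {0..})" for x
    by (intro bdd_belowI2) auto
  have qg: "q x \<le> g x t" if "0 \<le> t" for x t
    unfolding q_def using that by (intro cINF_lower bdd) auto
  have qI: "c \<le> q x" if "\<And>t. 0 \<le> t \<Longrightarrow> c \<le> g x t" for c x
    unfolding q_def using that by (intro cINF_greatest) auto
  show "q \<le> p"
    using qg[of 0] by (simp add: le_fun_def g_def)
  show "q x \<le> p (x + a) - p a" for x
    using qg[of 1 x] by (simp add: g_def)
  show "sublinear q"
  proof (rule sublinearI)
    fix x y
    \<comment> \<open>Parameters add: \<open>t\<close> for \<open>x\<close> and \<open>s\<close> for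
      \<open>y\<close> combine to \<open>t + s\<close> for \<open>x + y\<close>. The infima over
      \<open>t\<close> and \<open>s\<close> are then taken one after the other.\<close>
    have "q (x + y) - g y s \<le> g x t" if "0 \<le> t" "0 \<le> s" for t s
    proof -
      have "q (x + y) \<le> g (x + y) (t + s)"
        using that by (intro qg) auto
      also have "\<dots> \<le> g x t + g y s"
        using sublinear_add[OF p, of "x + t *\<^sub>R a" "y + s *\<^sub>R a"] by (simp add: g_def algebra_simps)
      finally show ?thesis by simp
    qed
    then have "q (x + y) - g y s \<le> q x" if "0 \<le> s" for s
      using that by (intro qI) auto
    then have "q (x + y) - q x \<le> q y"
      by (intro qI) (simp add: algebra_simps)
    then show "q (x + y) \<le> q x + q y" by simp
  next
    fix t :: real and x
    assume t: "0 \<le> t"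
    show "q (t *\<^sub>R x) \<le> t * q x"
    proof (cases "t = 0")
      case True
      then show ?thesis using qg[of 0 0] by (simp add: g_def sublinear_zero[OF p])
    next
      case False
      have "q (t *\<^sub>R x) / t \<le> g x s" if "0 \<le> s" for s
      proof -
        have "q (t *\<^sub>R x) \<le> g (t *\<^sub>R x) (t * s)"
          using that t by (intro qg) auto
        also have "\<dots> = t * g x s"
          using sublinear_scaleR[OF p t, of "x + s *\<^sub>R a"] by (simp add: g_def algebra_simps)
        finally show ?thesis using t False by (simp add: field_simps)
      qed
      then have "q (t *\<^sub>R x) / t \<le> q x" by (rule qI)
      then show ?thesis using t False by (simp add: field_simps)
    qed
  qed
qed

text \<open>Zorn's lemma for the reversed pointwise order below \<open>p\<close>. A nonempty chain
  is bounded by its pointwise infimum, which is finite because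
  \<open>- p (- x) \<le> - q (- x) \<le> q x\<close> for each member \<open>q\<close>.\<close>

lemma sublinear_dominates_minimal:
  assumes p: "sublinear p"
  obtains q where "sublinear q" "q \<le> p" "\<And>r. sublinear r \<Longrightarrow> r \<le> q \<Longrightarrow> r = q"
proof -
  define S where "S = {q. sublinear q \<and> q \<le> p}"
  have "\<exists>m\<in>S. \<forall>r\<in>S. r \<le> m \<longrightarrow> r = m"
  proof (rule predicate_Zorn)
    show "partial_order_on S (relation_of (\<lambda>x y. y \<le> x) S)"
      by (rule partial_order_on_relation_ofI) auto
  next
    fix C assume C: "C \<in> Chains (relation_of (\<lambda>x y. y \<le> x) S)"
    then have CS: "C \<subseteq> S" and chain: "\<And>q r. q \<in> C \<Longrightarrow> r \<in> C \<Longrightarrow> q \<le> r \<or> r \<le> q"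
      unfolding Chains_def relation_of_def by blast+
    show "\<exists>u\<in>S. \<forall>q\<in>C. u \<le> q"
    proof (cases "C = {}")
      case True
      then show ?thesis using p by (auto simp: S_def)
    next
      case False
      define u where "u x = (INF q\<in>C. q x)" for x
      have sub: "sublinear q" if "q \<in> C" for q
        using that CS by (auto simp: S_def)
      have "- p (- x) \<le> q x" if "q \<in> C" for q x
      proof -
        have "q (- x) \<le> p (- x)" using that CS by (auto simp: S_def le_fun_def)
        then show ?thesis using sublinear_minus[OF sub[OF that], of x] by linarith
      qed
      then have bdd: "bdd_below ((\<lambda>q. q x) ` C)" for x
        by (intro bdd_belowI2) auto
      have uq: "u x \<le> q x" if "q \<in> C" for q x
        unfolding u_def using that by (intro cINF_lower bdd) auto
      have uI: "c \<le> u x" if "\<And>q. q \<in> C \<Longrightarrow> c \<le> q x" for c x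
        unfolding u_def using that False by (intro cINF_greatest) auto
      have "sublinear u"
      proof (rule sublinearI)
        fix x y
        have "u (x + y) - r y \<le> q x" if "q \<in> C" "r \<in> C" for q r
        proof -
          \<comment> \<open>The smaller of \<open>q\<close> and \<open>r\<close> serves as
            \<open>s\<close>; comparability within the chain makes the infimum subadditive.\<close>
          have "u (x + y) \<le> q x + r y" if "s \<in> C" "s \<le> q" "s \<le> r" for s
            using uq[OF that(1), of "x + y"] sublinear_add[OF sub[OF that(1)], of x y]
              le_funD[OF that(2), of x] le_funD[OF that(3), of y] by linarith
          then show ?thesis
            using chain[OF that] that by (smt (verit) order_refl)
        qed
        then have "u (x + y) - r y \<le> u x" if "r \<in> C" for r
          using that by (intro uI) auto
        then have "u (x + y) - u x \<le> u y"
          by (intro uI) (simp add: algebra_simps)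
        then show "u (x + y) \<le> u x + u y" by simp
      next
        fix t :: real and x
        assume t: "0 \<le> t"
        have le: "u (t *\<^sub>R x) \<le> t * q x" if "q \<in> C" for q
          using uq[OF that, of "t *\<^sub>R x"] by (simp add: sublinear_scaleR[OF sub[OF that] t])
        show "u (t *\<^sub>R x) \<le> t * u x"
        proof (cases "t = 0")
          case True
          then show ?thesis using le False by auto
        next
          case False
          then have "u (t *\<^sub>R x) / t \<le> u x"
            using le t by (intro uI) (simp add: field_simps)
          then show ?thesis using t False by (simp add: field_simps)
        qed
      qed
      moreover have "u \<le> p"
      proof (rule le_funI)
        fix x
        obtain q where "q \<in> C" using False by blast
        then show "u x \<le> p x"
          using uq[of q x] CS le_funD[of q p x] by (auto simp: S_def)
      qed
      ultimately show ?thesis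
        using uq by (auto simp: S_def le_fun_def)
    qed
  qed
  then obtain m where m: "m \<in> S" and min: "\<And>r. r \<in> S \<Longrightarrow> r \<le> m \<Longrightarrow> r = m" by blast
  show ?thesis
  proof (rule that)
    show "sublinear m" "m \<le> p" using m by (auto simp: S_def)
    then show "r = m" if "sublinear r" "r \<le> m" for r
      using that by (intro min) (auto simp: S_def)
  qed
qed

text \<open>
  No extension of partial functionals is needed: a minimal sublinear functional is dominated by
  each of its own shifts, which forces additivity.
\<close>

theorem Hahn_Banach_sublinear:
  assumes p: "sublinear p"
  obtains f where "linear f" "f \<le> p" "f a = p a"
proof -
  \<comment> \<open>Shifting by \<open>a\<close> before minimizing yields
    \<open>q (- a) \<le> - p a\<close>, which forces \<open>f a = p a\<close> at the end.\<close>
  obtain q where q: "sublinear q" "q \<le> p" "\<And>x. q x \<le> p (x + a) - p a"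
    using sublinear_shift[OF p] by blast
  obtain f where f: "sublinear f" "f \<le> q" and min: "\<And>r. sublinear r \<Longrightarrow> r \<le> f \<Longrightarrow> r = f"
    using sublinear_dominates_minimal[OF q(1)] by blast
  have add: "f (x + y) = f x + f y" for x y
  proof -
    obtain r where r: "sublinear r" "r \<le> f" "\<And>x. r x \<le> f (x + y) - f y"
      using sublinear_shift[OF f(1)] by blast
    then have "f x \<le> f (x + y) - f y"
      using min[OF r(1,2)] by auto
    then show ?thesis
      using sublinear_add[OF f(1), of x y] by simp
  qed
  have minus: "f (- x) = - f x" for x
    using add[of x "- x"] by (simp add: sublinear_zero[OF f(1)])
  have "f (t *\<^sub>R x) = t * f x" for t x
  proof (cases "0 \<le> t")
    case True
    then show ?thesis by (rule sublinear_scaleR[OF f(1)])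
  next
    case False
    then show ?thesis
      using sublinear_scaleR[OF f(1), of "- t" x] minus[of "t *\<^sub>R x"] by simp
  qed
  then have "linear f"
    by (intro linearI) (auto simp: add)
  moreover have "f \<le> p" using f(2) q(2) by simp
  moreover have "f a = p a"
  proof (rule antisym)
    show "f a \<le> p a" using \<open>f \<le> p\<close> by (simp add: le_fun_def)
    have "f (- a) \<le> q (- a)" using f(2) by (simp add: le_fun_def)
    then show "p a \<le> f a"
      using q(3)[of "- a"] minus[of a] by (simp add: sublinear_zero[OF p])
  qed
  ultimately show ?thesis by (rule that)
qed

text \<open>This is the quotient seminorm modulo \<open>Y\<close>: sums and multiples of points of
  \<open>Y\<close> close to the given vectors stay in \<open>Y\<close> and so compete in the
  infimum.\<close>

lemma sublinear_infdist_subspace: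
  fixes Y :: "'a::real_normed_vector set"
  assumes "subspace Y"
  shows "sublinear (\<lambda>x. infdist x Y)"
proof (rule sublinearI)
  have "0 \<in> Y" using assms by (rule subspace_0)
  then have ne: "Y \<noteq> {}" by auto
  have infI: "c \<le> infdist x Y" if "\<And>z. z \<in> Y \<Longrightarrow> c \<le> dist x z" for c and x :: 'a
    unfolding infdist_notempty[OF ne] using that ne by (intro cINF_greatest) auto
  fix x y :: 'a
  have "infdist (x + y) Y - dist y v \<le> dist x u" if "u \<in> Y" "v \<in> Y" for u v
    using infdist_le[OF subspace_add[OF assms that], of "x + y"] norm_triangle_ineq[of "x - u" "y - v"]
    by (simp add: dist_norm algebra_simps)
  then have "infdist (x + y) Y - dist y v \<le> infdist x Y" if "v \<in> Y" for v
    using that by (intro infI)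
  then have "infdist (x + y) Y - infdist x Y \<le> infdist y Y"
    by (intro infI) (simp add: algebra_simps)
  then show "infdist (x + y) Y \<le> infdist x Y + infdist y Y" by simp
  fix t :: real
  assume t: "0 \<le> t"
  have le: "infdist (t *\<^sub>R x) Y \<le> t * dist x u" if "u \<in> Y" for u
    using infdist_le[OF subspace_scale[OF assms that, of t], of "t *\<^sub>R x"] t
    by (simp add: dist_norm flip: scaleR_diff_right)
  show "infdist (t *\<^sub>R x) Y \<le> t * infdist x Y"
  proof (cases "t = 0")
    case True
    then show ?thesis using \<open>0 \<in> Y\<close> by simp
  next
    case False
    then have "infdist (t *\<^sub>R x) Y / t \<le> infdist x Y"
      using t le by (intro infI) (simp add: field_simps)
    then show ?thesis using t False by (simp add: field_simps)
  qed
qed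


section \<open>Bounded complex-linear maps\<close>

text \<open>Lets functionals be treated as \<open>bounded_clinear\<close> maps.\<close>

instantiation complex :: complex_normed_vector
begin

definition scaleC_complex :: "complex \<Rightarrow> complex \<Rightarrow> complex" where
  "scaleC_complex c x = c * x"

instance
  by standard (auto simp: scaleC_complex_def algebra_simps norm_mult scaleR_conv_of_real)

end

lemma bounded_clinear_iff:
  "bounded_clinear S \<longleftrightarrow> (\<forall>x y. S (x + y) = S x + S y) \<and> (\<forall>c x. S (c *\<^sub>C x) = c *\<^sub>C S x) \<and>
    (\<exists>K. \<forall>x. norm (S x) \<le> norm x * K)"
  unfolding bounded_clinear_def Vector_Spaces.linear_iff
  by (auto simp: complex_vector.vector_space_axioms)

lemma bounded_clinear_add: "bounded_clinear S \<Longrightarrow> S (x + y) = S x + S y"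
  and bounded_clinear_scaleC: "bounded_clinear S \<Longrightarrow> S (c *\<^sub>C x) = c *\<^sub>C S x"
  by (auto simp: bounded_clinear_iff)

lemma bounded_clinear_imp_bounded_linear:
  assumes "bounded_clinear S"
  shows "bounded_linear S"
proof -
  obtain K where "\<And>x. norm (S x) \<le> norm x * K"
    using assms by (auto simp: bounded_clinear_iff)
  then show ?thesis
    using assms
    by (intro bounded_linear_intro[where K = K])
      (auto simp: bounded_clinear_add bounded_clinear_scaleC simp flip: scaleC_of_real)
qed

lemma bounded_clinear_diff: "bounded_clinear S \<Longrightarrow> S (x - y) = S x - S y"
  by (simp add: bounded_clinear_imp_bounded_linear linear_diff bounded_linear.linear)

lemma bounded_clinear_zero: "bounded_clinear S \<Longrightarrow> S 0 = 0"
  by (simp add: bounded_clinear_imp_bounded_linear linear_0 bounded_linear.linear)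

lemma bounded_clinear_pos_bound:
  assumes "bounded_clinear S"
  obtains K where "K > 0" "\<And>x. norm (S x) \<le> norm x * K"
  using bounded_linear.pos_bounded[OF bounded_clinear_imp_bounded_linear[OF assms]] by blast

lemma bounded_clinear_tendsto:
  "bounded_clinear S \<Longrightarrow> (g \<longlongrightarrow> l) F \<Longrightarrow> ((\<lambda>x. S (g x)) \<longlongrightarrow> S l) F"
  using bounded_clinear_imp_bounded_linear bounded_linear.tendsto by blast

lemma bounded_clinearI:
  assumes "bounded_linear S" "\<And>c x. S (c *\<^sub>C x) = c *\<^sub>C S x"
  shows "bounded_clinear S"
  using assms bounded_linear.bounded[OF assms(1)]
  by (auto simp: bounded_clinear_iff linear_add bounded_linear.linear)

lemma bounded_linear_scaleC_const: "bounded_linear (\<lambda>x. c *\<^sub>C x)"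
  by (intro bounded_linear_intro[where K = "cmod c"])
    (auto simp: scaleC_add_right scaleC_scaleC norm_scaleC mult.commute simp flip: scaleC_of_real)

lemma bounded_clinear_scaleC_const: "bounded_clinear (\<lambda>x. c *\<^sub>C x)"
  by (intro bounded_clinearI bounded_linear_scaleC_const) (simp add: scaleC_scaleC mult.commute)

lemma bounded_clinear_vector: "bounded_clinear (\<lambda>c. c *\<^sub>C y)"
  unfolding bounded_clinear_iff
  by (auto simp: scaleC_add_left scaleC_scaleC norm_scaleC scaleC_complex_def)

lemma bounded_clinear_id: "bounded_clinear (\<lambda>x. x)"
  by (auto intro: bounded_clinearI bounded_linear_ident)

lemma bounded_clinear_compose:
  "bounded_clinear S \<Longrightarrow> bounded_clinear R \<Longrightarrow> bounded_clinear (\<lambda>x. S (R x))"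
  by (auto intro!: bounded_clinearI bounded_linear_compose[of S R]
      simp: bounded_clinear_imp_bounded_linear bounded_clinear_scaleC)

lemma bounded_clinear_plus:
  "bounded_clinear S \<Longrightarrow> bounded_clinear R \<Longrightarrow> bounded_clinear (\<lambda>x. S x + R x)"
  by (auto intro!: bounded_clinearI bounded_linear_add
      simp: bounded_clinear_imp_bounded_linear bounded_clinear_scaleC scaleC_add_right)

lemma bounded_clinear_minus:
  "bounded_clinear S \<Longrightarrow> bounded_clinear R \<Longrightarrow> bounded_clinear (\<lambda>x. S x - R x)"
  by (auto intro!: bounded_clinearI bounded_linear_sub
      simp: bounded_clinear_imp_bounded_linear bounded_clinear_scaleC
        complex_vector.scale_right_diff_distrib)

lemma bounded_clinear_scaleC_fun:
  "bounded_clinear S \<Longrightarrow> bounded_clinear (\<lambda>x. c *\<^sub>C S x)"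
  by (rule bounded_clinear_compose[OF bounded_clinear_scaleC_const])

lemmas bounded_clinear_intros =
  bounded_clinear_id bounded_clinear_plus bounded_clinear_minus bounded_clinear_scaleC_fun
  bounded_clinear_scaleC_const bounded_clinear_compose[OF bounded_clinear_vector]

lemma bounded_clinear_funpow:
  fixes S :: "'a::complex_normed_vector \<Rightarrow> 'a"
  shows "bounded_clinear S \<Longrightarrow> bounded_clinear (S ^^ n)"
proof (induction n)
  case 0
  show ?case using bounded_clinear_id by (simp add: id_def)
next
  case (Suc n)
  then show ?case using bounded_clinear_compose[of S "S ^^ n"] by (simp add: comp_def)
qed

section \<open>Separating functionals and the form of rank one operators\<close>

lemma complex_subspace_imp_subspace: "complex_vector.subspace Y \<Longrightarrow> subspace Y"
  by (auto simp: complex_vector.subspace_def subspace_def simp flip: scaleC_of_real)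

text \<open>A real functional dominated by the distance to \<open>Y\<close> vanishes on
  \<open>Y\<close>; if it attains that distance at \<open>a\<close>, it is positive there because
  \<open>Y\<close> is closed. Its complexification is the required \<open>f\<close>.\<close>

theorem Hahn_Banach_separation:
  fixes Y :: "'a::complex_normed_vector set"
  assumes Y: "complex_vector.subspace Y" "closed Y" and a: "a \<notin> Y"
  obtains f :: "'a \<Rightarrow> complex" where "bounded_clinear f" "\<And>y. y \<in> Y \<Longrightarrow> f y = 0" "f a \<noteq> 0"
proof -
  have sub: "subspace Y" using Y(1) by (rule complex_subspace_imp_subspace)
  obtain g where g: "linear g" "g \<le> (\<lambda>x. infdist x Y)" "g a = infdist a Y"
    using Hahn_Banach_sublinear[OF sublinear_infdist_subspace[OF sub]] by blast
  have le: "g x \<le> infdist x Y" for x using g(2) by (simp add: le_fun_def)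
  have gY: "g y = 0" if "y \<in> Y" for y
    using le[of y] le[of "- y"] that subspace_neg[OF sub that] by (simp add: linear_neg[OF g(1)])
  have "infdist x Y \<le> norm x" for x
    using infdist_le[OF subspace_0[OF sub], of x] by simp
  then have bound: "\<bar>g x\<bar> \<le> norm x" for x
    using le[of x] le[of "- x"] linear_neg[OF g(1), of x]
    by (smt (verit) norm_minus_cancel)
  \<comment> \<open>The unique complex-linear functional with real part \<open>g\<close>.\<close>
  define f where "f x = Complex (g x) (- g (\<i> *\<^sub>C x))" for x
  have f_add: "f (x + y) = f x + f y" for x y
    by (simp add: f_def linear_add[OF g(1)] scaleC_add_right complex_eq_iff)
  have gc: "g (c *\<^sub>C x) = Re c * g x + Im c * g (\<i> *\<^sub>C x)" for c x
  proof -
    have "c *\<^sub>C x = Re c *\<^sub>R x + Im c *\<^sub>R (\<i> *\<^sub>C x)"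
      by (simp add: scaleC_scaleC complex_eq mult.commute flip: scaleC_of_real scaleC_add_left)
    then show ?thesis by (simp add: linear_add[OF g(1)] linear_scale[OF g(1)])
  qed
  have f_scale: "f (c *\<^sub>C x) = c *\<^sub>C f x" for c x
    using gc[of c x] gc[of "\<i> * c" x] by (simp add: f_def scaleC_complex_def complex_eq_iff scaleC_scaleC)
  have "norm (f x) \<le> norm x * 2" for x
    using cmod_le[of "f x"] bound[of x] bound[of "\<i> *\<^sub>C x"] by (simp add: f_def norm_scaleC)
  then have "bounded_clinear f"
    using f_add f_scale by (auto simp: bounded_clinear_iff)
  moreover have "f y = 0" if "y \<in> Y" for y
    using that gY complex_vector.subspace_scale[OF Y(1) that] by (simp add: f_def complex_eq_iff)
  moreover have "f a \<noteq> 0"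
  proof -
    have "Y \<noteq> {}" using subspace_0[OF sub] by blast
    then show ?thesis
      using infdist_pos_not_in_closed[OF Y(2) _ a] g(3) by (auto simp: f_def complex_eq_iff)
  qed
  ultimately show ?thesis by (rule that)
qed

text \<open>\<open>F\<close> is the tensor \<open>y \<otimes> f\<close>: the vector \<open>y\<close>
  spans the range, and \<open>f\<close> is the coordinate along \<open>y\<close>, bounded by a bound
  of \<open>F\<close> divided by \<open>norm y\<close>.\<close>

lemma rank_one_iff:
  fixes F :: "'a::complex_normed_vector \<Rightarrow> 'b::complex_normed_vector"
  shows "rank_one F \<longleftrightarrow>
    (\<exists>f y. bounded_clinear f \<and> (\<exists>x. f x \<noteq> (0::complex)) \<and> y \<noteq> 0 \<and> F = (\<lambda>x. f x *\<^sub>C y))"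
proof (intro iffI)
  assume "rank_one F"
  then have F: "bounded_clinear F" and dim: "complex_vector.dim (range F) = 1"
    by (auto simp: rank_one_def)
  obtain B where B: "B \<subseteq> range F" "complex_vector.independent B"
      "range F \<subseteq> complex_vector.span B" "card B = 1"
    using complex_vector.basis_exists[of "range F"] dim by metis
  then obtain y where y: "B = {y}" by (auto simp: card_1_singleton_iff)
  have "y \<noteq> 0" using B(2) y by (auto simp: complex_vector.dependent_zero)
  have "\<exists>c. F x = c *\<^sub>C y" for x
    using B(3) unfolding y complex_vector.span_singleton by auto
  then obtain f where f: "F x = f x *\<^sub>C y" for x by metis
  have inj: "c = d" if "c *\<^sub>C y = d *\<^sub>C y" for c d
    using that \<open>y \<noteq> 0\<close> by simp
  have "f (u + v) = f u + f v" for u v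
    using bounded_clinear_add[OF F, of u v] by (intro inj) (simp add: f scaleC_add_left)
  moreover have "f (c *\<^sub>C u) = c *\<^sub>C f u" for c u
    using bounded_clinear_scaleC[OF F, of c u]
    by (intro inj) (simp add: f scaleC_scaleC scaleC_complex_def)
  moreover obtain K where K: "\<And>x. norm (F x) \<le> norm x * K"
    using F by (auto simp: bounded_clinear_iff)
  have "norm (f x) \<le> norm x * (K / norm y)" for x
    using K[of x] \<open>y \<noteq> 0\<close> by (simp add: f norm_scaleC field_simps)
  ultimately have "bounded_clinear f"
    unfolding bounded_clinear_iff by blast
  moreover have "\<exists>x. f x \<noteq> 0"
  proof -
    obtain x where x: "y = F x" using B(1) y by auto
    have "f x \<noteq> 0"
    proof
      assume "f x = 0"
      then have "F x = 0" by (simp add: f)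
      then show False using x \<open>y \<noteq> 0\<close> by simp
    qed
    then show ?thesis ..
  qed
  ultimately show "\<exists>f y. bounded_clinear f \<and> (\<exists>x. f x \<noteq> (0::complex)) \<and> y \<noteq> 0 \<and> F = (\<lambda>x. f x *\<^sub>C y)"
    using \<open>y \<noteq> 0\<close> f by blast
next
  assume "\<exists>f y. bounded_clinear f \<and> (\<exists>x. f x \<noteq> (0::complex)) \<and> y \<noteq> 0 \<and> F = (\<lambda>x. f x *\<^sub>C y)"
  then obtain f y x where f: "bounded_clinear f" "f x \<noteq> (0::complex)" and y: "y \<noteq> 0"
    and F: "F = (\<lambda>x. f x *\<^sub>C y)" by blast
  have "c *\<^sub>C y \<in> range F" for c
  proof
    show "c *\<^sub>C y = F ((c / f x) *\<^sub>C x)"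
      using f by (simp add: F bounded_clinear_scaleC scaleC_complex_def)
  qed simp
  then have "range F = complex_vector.span {y}"
    by (auto simp: complex_vector.span_singleton F)
  moreover have "complex_vector.dim {y} = card {y}"
    using y by (intro complex_vector.dim_eq_card_independent) simp
  ultimately have "complex_vector.dim (range F) = 1" by simp
  moreover have "bounded_clinear F"
    unfolding F by (intro bounded_clinear_intros f)
  ultimately show "rank_one F" by (simp add: rank_one_def)
qed


section \<open>The Fredholm resolvent of a quasinilpotent operator\<close>

text \<open>Provides the neighbourhood of \<open>v\<close> on which the estimate of
  \<open>A_local_bound\<close> applies.\<close>

lemma eventually_cmod_diff_mult_le_half:
  fixes K :: real
  assumes "K > 0"
  shows "\<forall>\<^sub>F w in at v. cmod (w - v) * K \<le> 1/2"
proof -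
  have "((\<lambda>w. cmod (w - v) * K) \<longlongrightarrow> cmod (v - v) * K) (at v)"
    by (intro tendsto_intros)
  then have "\<forall>\<^sub>F w in at v. cmod (w - v) * K < 1/2"
    by (rule order_tendstoD) simp
  then show ?thesis by (rule eventually_mono) simp
qed

text \<open>
  \<open>A w\<close> is the inverse of \<open>I - wT\<close>. Unlike the resolvent \<open>z \<mapsto> (zI - T)\<inverse>\<close>, it is entire when \<open>T\<close> is
  quasinilpotent.
\<close>

locale entire_fredholm_resolvent =
  fixes T :: "'a::complex_normed_vector \<Rightarrow> 'a" and A :: "complex \<Rightarrow> 'a \<Rightarrow> 'a"
  assumes T: "bounded_clinear T"
    and A: "bounded_clinear (A w)"
    and A_left: "A w (x - w *\<^sub>C T x) = x"
    and A_right: "A w x - w *\<^sub>C T (A w x) = x"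
begin

section \<open>Resolvent identity and regularity in the parameter\<close>

lemma A_eq: "A w x = x + w *\<^sub>C T (A w x)"
  using A_right[of w x] by (metis diff_eq_eq)

text \<open>The resolvent identity: with \<open>u = A w x\<close>, rewrite
  \<open>x = (I - wT) u\<close> as \<open>(I - vT) u - (w - v) T u\<close> and apply
  \<open>A v\<close>.\<close>

lemma A_diff: "A w x - A v x = (w - v) *\<^sub>C A v (T (A w x))"
proof -
  define u where "u = A w x"
  have "x = (u - v *\<^sub>C T u) - (w - v) *\<^sub>C T u"
    using A_right[of w x] by (simp add: u_def complex_vector.scale_left_diff_distrib)
  then have "A v x = A v (u - v *\<^sub>C T u) - A v ((w - v) *\<^sub>C T u)"
    using bounded_clinear_diff[OF A] by metis
  also have "\<dots> = u - (w - v) *\<^sub>C A v (T u)"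
    by (simp only: bounded_clinear_scaleC[OF A] A_left)
  finally show ?thesis by (simp add: u_def)
qed

text \<open>By the resolvent identity, \<open>A w x\<close> differs from \<open>A v x\<close> by at
  most half of \<open>norm (A w x)\<close>, which is absorbed on the left.\<close>

lemma A_local_bound:
  obtains K where "K > 0"
    "\<And>x. norm (A v (T x)) \<le> norm x * K"
    "\<And>w x. cmod (w - v) * K \<le> 1/2 \<Longrightarrow> norm (A w x) \<le> 2 * norm (A v x)"
proof -
  obtain K where K: "K > 0" "\<And>x. norm (A v (T x)) \<le> norm x * K"
    using bounded_clinear_pos_bound[OF bounded_clinear_compose[OF A T]] by blast
  show ?thesis
  proof (rule that[OF K])
    fix w x assume w: "cmod (w - v) * K \<le> 1/2"
    have "norm (A w x - A v x) = cmod (w - v) * norm (A v (T (A w x)))"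
      by (simp add: A_diff norm_scaleC)
    also have "\<dots> \<le> cmod (w - v) * (norm (A w x) * K)"
      by (intro mult_left_mono K) auto
    also have "\<dots> = cmod (w - v) * K * norm (A w x)"
      by simp
    also have "\<dots> \<le> 1/2 * norm (A w x)"
      using w by (intro mult_right_mono) auto
    finally show "norm (A w x) \<le> 2 * norm (A v x)"
      using norm_triangle_ineq2[of "A w x" "A v x"] by simp
  qed
qed

lemma A_continuous: "isCont (\<lambda>w. A w x) v"
proof -
  obtain K where K: "K > 0" "\<And>x. norm (A v (T x)) \<le> norm x * K"
    "\<And>w x. cmod (w - v) * K \<le> 1/2 \<Longrightarrow> norm (A w x) \<le> 2 * norm (A v x)"
    using A_local_bound by blast
  have "((\<lambda>w. A w x - A v x) \<longlongrightarrow> 0) (at v)"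
  proof (rule Lim_null_comparison)
    have "((\<lambda>w. cmod (w - v) * (2 * norm (A v x) * K)) \<longlongrightarrow> cmod (v - v) * (2 * norm (A v x) * K)) (at v)"
      by (intro tendsto_intros)
    then show "((\<lambda>w. cmod (w - v) * (2 * norm (A v x) * K)) \<longlongrightarrow> 0) (at v)" by simp
    show "\<forall>\<^sub>F w in at v. norm (A w x - A v x) \<le> cmod (w - v) * (2 * norm (A v x) * K)"
      using eventually_cmod_diff_mult_le_half[OF K(1), of v]
    proof (rule eventually_mono)
      fix w assume w: "cmod (w - v) * K \<le> 1/2"
      have "norm (A v (T (A w x))) \<le> norm (A w x) * K" by (rule K)
      also have "\<dots> \<le> 2 * norm (A v x) * K"
        using K(3)[OF w] K(1) by (intro mult_right_mono) auto
      finally show "norm (A w x - A v x) \<le> cmod (w - v) * (2 * norm (A v x) * K)"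
        by (simp add: A_diff norm_scaleC mult_left_mono)
    qed
  qed
  then show ?thesis
    by (simp add: isCont_def LIM_zero_iff)
qed

text \<open>With \<open>v\<close> and \<open>w\<close> exchanged in the resolvent identity, the
  difference quotient is exactly \<open>g (A w (T (A v x)))\<close>, so continuity of
  \<open>A\<close> at one fixed vector gives the limit.\<close>

lemma functional_A_has_field_derivative:
  fixes g :: "'a \<Rightarrow> complex"
  assumes g: "bounded_clinear g"
  shows "((\<lambda>w. g (A w x)) has_field_derivative g (A v (T (A v x)))) (at v)"
  unfolding has_field_derivative_iff
proof (rule Lim_transform_eventually)
  show "((\<lambda>w. g (A w (T (A v x)))) \<longlongrightarrow> g (A v (T (A v x)))) (at v)"
    using A_continuous[where x = "T (A v x)" and v = v] unfolding isCont_def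
    by (rule bounded_clinear_tendsto[OF g])
  have "A w x - A v x = (w - v) *\<^sub>C A w (T (A v x))" for w
    using A_diff[of v x w] by (metis complex_vector.scale_minus_left minus_diff_eq)
  then have "g (A w x) - g (A v x) = (w - v) * g (A w (T (A v x)))" for w
    by (simp add: bounded_clinear_scaleC[OF g] scaleC_complex_def flip: bounded_clinear_diff[OF g])
  then show "\<forall>\<^sub>F w in at v. g (A w (T (A v x))) = (g (A w x) - g (A v x)) / (w - v)"
    by (auto simp: eventually_at intro: exI[of _ 1])
qed

text \<open>The set of \<open>w\<close> for which \<open>A w\<close> leaves \<open>Y\<close> invariant is clopen and contains \<open>0\<close>.\<close>

lemma A_invariant:
  assumes Y: "complex_vector.subspace Y" "closed Y" and TY: "T ` Y \<subseteq> Y" and "y \<in> Y"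
  shows "A w y \<in> Y"
proof -
  define S where "S = {w. \<forall>y\<in>Y. A w y \<in> Y}"
  have ne: "Y \<noteq> {}" using \<open>y \<in> Y\<close> by blast
  have "open S"
    unfolding open_dist
  proof
    fix v assume "v \<in> S"
    obtain K where K: "K > 0" "\<And>x. norm (A v (T x)) \<le> norm x * K"
      using A_local_bound[of v] by metis
    have "w \<in> S" if "dist w v < 1 / (2 * K)" for w
      unfolding S_def
    proof (intro CollectI ballI)
      fix y assume y: "y \<in> Y"
      define u where "u = A w y"
      have u: "u = (w - v) *\<^sub>C A v (T u) + A v y"
        using A_diff[of w y v] unfolding u_def diff_eq_eq .
      have w: "cmod (w - v) * K \<le> 1/2"
        using that K(1) by (simp add: dist_norm field_simps)
      \<comment> \<open>The map \<open>z \<mapsto> (w - v) A v (T z) + A v y\<close> preserves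
        \<open>Y\<close>, fixes \<open>u\<close> and contracts by the factor 1/2. Comparing
        \<open>u\<close> with the image \<open>b\<close> of \<open>z\<close> therefore halves the
        distance to \<open>Y\<close>, which must be zero.\<close>
      have le: "2 * infdist u Y \<le> dist u z" if z: "z \<in> Y" for z
      proof -
        define b where "b = (w - v) *\<^sub>C A v (T z) + A v y"
        have "A v y \<in> Y" "A v (T z) \<in> Y"
          using \<open>v \<in> S\<close> y z TY by (auto simp: S_def)
        then have "b \<in> Y"
          unfolding b_def
          using complex_vector.subspace_add[OF Y(1)] complex_vector.subspace_scale[OF Y(1)] by blast
        then have "infdist u Y \<le> norm (u - b)"
          using infdist_le[of b Y u] by (simp add: dist_norm)
        also have "u - b = (w - v) *\<^sub>C A v (T u) + A v y - b"
          using arg_cong[OF u, of "\<lambda>t. t - b"] .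
        also have "\<dots> = (w - v) *\<^sub>C (A v (T u) - A v (T z))"
          by (simp add: b_def complex_vector.scale_right_diff_distrib)
        also have "\<dots> = (w - v) *\<^sub>C A v (T (u - z))"
          by (simp only: bounded_clinear_diff[OF A] bounded_clinear_diff[OF T])
        also have "norm \<dots> \<le> cmod (w - v) * (norm (u - z) * K)"
          unfolding norm_scaleC by (intro mult_left_mono K) auto
        also have "\<dots> = cmod (w - v) * K * norm (u - z)"
          by simp
        also have "\<dots> \<le> 1/2 * norm (u - z)"
          using w by (intro mult_right_mono) auto
        finally show ?thesis by (simp add: dist_norm)
      qed
      have "2 * infdist u Y \<le> infdist u Y"
        using le by (subst (2) infdist_notempty[OF ne]) (intro cINF_greatest ne)
      then have "infdist u Y = 0" using infdist_nonneg[of u Y] by simp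
      then show "A w y \<in> Y"
        unfolding u_def by (rule iffD2[OF in_closed_iff_infdist_zero[OF Y(2) ne]])
    qed
    then show "\<exists>e>0. \<forall>w. dist w v < e \<longrightarrow> w \<in> S"
      using K(1) by (intro exI[of _ "1 / (2 * K)"]) auto
  qed
  moreover have "closed S"
  proof -
    have "S = (\<Inter>y\<in>Y. (\<lambda>w. A w y) -` Y)" by (auto simp: S_def)
    then show ?thesis
      using Y(2) A_continuous
      by (auto intro!: closed_INT continuous_closed_vimage)
  qed
  moreover have "0 \<in> S"
    using A_right[of 0] by (simp add: S_def)
  ultimately have "S = UNIV" using clopen[of S] by blast
  then show ?thesis using \<open>y \<in> Y\<close> by (auto simp: S_def)
qed

text \<open>Replaces reading off Taylor coefficients. If \<open>g (T^n (A w y))\<close> vanishes for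
  all \<open>w\<close>, inserting \<open>A w y = y + w T (A w y)\<close> leaves
  \<open>w g (T^(n+1) (A w y)) = 0\<close>; divide for \<open>w \<noteq> 0\<close> and use
  continuity at \<open>0\<close>.\<close>

lemma functional_orbit_eq_zero:
  fixes g :: "'a \<Rightarrow> complex"
  assumes g: "bounded_clinear g" and 0: "\<And>w. w \<noteq> 0 \<Longrightarrow> g (A w y) = 0"
  shows "g ((T ^^ n) y) = 0"
proof -
  have at_0: "h (A 0 y) = 0" if h: "bounded_clinear h" and "\<And>w. w \<noteq> 0 \<Longrightarrow> h (A w y) = 0"
    for h :: "'a \<Rightarrow> complex"
  proof (rule LIM_unique)
    show "((\<lambda>w. h (A w y)) \<longlongrightarrow> h (A 0 y)) (at 0)"
      using A_continuous[where x = y and v = 0] unfolding isCont_def by (rule bounded_clinear_tendsto[OF h])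
    show "((\<lambda>w. h (A w y)) \<longlongrightarrow> 0) (at 0)"
      using that(2) by (intro tendsto_eventually) (auto simp: eventually_at intro: exI[of _ 1])
  qed
  have A0: "A 0 x = x" for x using A_eq[of 0 x] by simp
  have gT: "bounded_clinear (\<lambda>x. g ((T ^^ n) x))" for n
    by (rule bounded_clinear_compose[OF g bounded_clinear_funpow[OF T]])
  have "g ((T ^^ n) (A w y)) = 0" for w
  proof (induction n arbitrary: w)
    case 0
    then show ?case using assms(2) at_0[OF g assms(2)] by (cases "w = 0") auto
  next
    case (Suc n)
    have *: "g ((T ^^ Suc n) (A w y)) = 0" if "w \<noteq> 0" for w
    proof -
      have "0 = g ((T ^^ n) (y + w *\<^sub>C T (A w y)))"
        using Suc.IH[of w] by (simp flip: A_eq)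
      also have "\<dots> = g ((T ^^ n) (A 0 y)) + w * g ((T ^^ n) (T (A w y)))"
        by (simp add: bounded_clinear_add[OF gT] bounded_clinear_scaleC[OF gT] A0 scaleC_complex_def)
      finally show ?thesis
        using that Suc.IH[of 0] by (simp add: funpow_swap1)
    qed
    show ?case
      using * at_0[OF gT[of "Suc n"] *] by (cases "w = 0") auto
  qed
  from this[of 0] show ?thesis by (simp add: A0)
qed

lemma functional_orbit_eq_zero_of_omits_two_values:
  fixes g :: "'a \<Rightarrow> complex"
  assumes g: "bounded_clinear g" and "a \<noteq> b" and omit: "\<And>w. w * g (A w y) \<noteq> a" "\<And>w. w * g (A w y) \<noteq> b"
  shows "g ((T ^^ n) y) = 0"
proof -
  define h where "h w = w * g (A w y)" for w
  have "(h has_field_derivative (1 * g (A v y) + g (A v (T (A v y))) * v)) (at v)" for v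
    unfolding h_def by (intro DERIV_mult DERIV_ident functional_A_has_field_derivative[OF g])
  then have "h holomorphic_on UNIV"
    unfolding holomorphic_on_def field_differentiable_def by blast
  moreover have "range h \<inter> {a, b} = {}"
    using omit by (auto simp: h_def)
  ultimately obtain c where "h = (\<lambda>w. c)"
    using little_Picard[OF _ \<open>a \<noteq> b\<close>] by blast
  \<comment> \<open>The factor \<open>w\<close> gives \<open>h 0 = 0\<close>, so the constant is
    zero.\<close>
  then have "h w = h 0" for w by simp
  then have "w * g (A w y) = 0" for w
    by (simp add: h_def)
  then show ?thesis
    by (intro functional_orbit_eq_zero[OF g]) (metis mult_eq_0_iff)
qed

end

section \<open>Invertibility, and the resolvent family from quasinilpotence\<close>

lemma invertible_opI:
  assumes "bounded_clinear S" "bounded_clinear R" "\<And>x. R (S x) = x" "\<And>x. S (R x) = x"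
  shows "invertible_op S"
  using assms by (auto simp: invertible_op_def fun_eq_iff)

lemma invertible_opE:
  assumes "invertible_op S"
  obtains R where "bounded_clinear R" "\<And>x. R (S x) = x" "\<And>x. S (R x) = x"
  using assms by (auto simp: invertible_op_def fun_eq_iff)

lemma quasinilpotent_imp_invertible:
  assumes "quasinilpotent S" "z \<noteq> 0"
  shows "invertible_op (\<lambda>x. z *\<^sub>C x - S x)"
  using assms by (auto simp: quasinilpotent_def op_spectrum_def)

text \<open>For \<open>w \<noteq> 0\<close>, \<open>I - wT = w (inverse w I - T)\<close> is
  invertible since \<open>inverse w\<close> is outside the spectrum; for \<open>w = 0\<close> it is
  the identity.\<close>

lemma quasinilpotent_fredholm_resolvent:
  assumes "quasinilpotent T"
  obtains A where "entire_fredholm_resolvent T A"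
proof -
  have T: "bounded_clinear T" using assms by (simp add: quasinilpotent_def)
  have "\<exists>B. bounded_clinear B \<and> (\<forall>x. B (x - w *\<^sub>C T x) = x) \<and> (\<forall>x. B x - w *\<^sub>C T (B x) = x)" for w
  proof (cases "w = 0")
    case True
    then show ?thesis using bounded_clinear_id by auto
  next
    case False
    then obtain R where R: "bounded_clinear R" "\<And>x. R (inverse w *\<^sub>C x - T x) = x"
        "\<And>x. inverse w *\<^sub>C R x - T (R x) = x"
      using invertible_opE[OF quasinilpotent_imp_invertible[OF assms, of "inverse w"]] by auto
    have eq: "x - w *\<^sub>C T x = w *\<^sub>C (inverse w *\<^sub>C x - T x)" for x
      using False by (simp add: complex_vector.scale_right_diff_distrib scaleC_scaleC)
    have "bounded_clinear (\<lambda>x. inverse w *\<^sub>C R x)"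
      by (intro bounded_clinear_intros R)
    moreover have "inverse w *\<^sub>C R (x - w *\<^sub>C T x) = x" for x
      unfolding eq using False by (simp add: bounded_clinear_scaleC[OF R(1)] R scaleC_scaleC)
    moreover have "inverse w *\<^sub>C R x - w *\<^sub>C T (inverse w *\<^sub>C R x) = x" for x
      using False R(3)[of x] by (simp add: bounded_clinear_scaleC[OF T] scaleC_scaleC)
    ultimately show ?thesis by blast
  qed
  then obtain A where "\<And>w. bounded_clinear (A w)" "\<And>w x. A w (x - w *\<^sub>C T x) = x"
      "\<And>w x. A w x - w *\<^sub>C T (A w x) = x"
    by metis
  then show ?thesis
    using T by (intro that[of A]) (simp add: entire_fredholm_resolvent_def)
qed


section \<open>Rank one perturbations and invariant subspaces\<close>

text \<open>
  Both \<open>f\<close> and \<open>y\<close> are tied to \<open>Y\<close>, so \<open>f (A w y) = 0\<close> and the inverse of \<open>zI - T - y \<otimes> f\<close> is given by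
  an explicit Sherman--Morrison formula. That \<open>0\<close> stays in the spectrum needs a separate argument:
  if \<open>U = T + y \<otimes> f\<close> had an inverse, then \<open>U\<inverse> y\<close> would be the limit of \<open>- w A w y\<close> as
  \<open>w \<rightarrow> \<infinity>\<close>, hence a member of \<open>Y\<close>, which makes \<open>T\<close> itself invertible.
\<close>

lemma quasinilpotent_rank_one_perturbation:
  fixes T :: "'a::complex_normed_vector \<Rightarrow> 'a" and f :: "'a \<Rightarrow> complex"
  assumes T: "quasinilpotent T"
    and Y: "complex_vector.subspace Y" "closed Y" "T ` Y \<subseteq> Y"
    and f: "bounded_clinear f" "\<And>x. x \<in> Y \<Longrightarrow> f x = 0" and y: "y \<in> Y"
  shows "quasinilpotent (\<lambda>x. T x + f x *\<^sub>C y)"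
proof -
  have bT: "bounded_clinear T" and "0 \<in> op_spectrum T"
    using T by (auto simp: quasinilpotent_def)
  obtain A where "entire_fredholm_resolvent T A"
    using quasinilpotent_fredholm_resolvent[OF T] by blast
  then interpret entire_fredholm_resolvent T A .
  note T_simps = bounded_clinear_add[OF bT] bounded_clinear_diff[OF bT] bounded_clinear_scaleC[OF bT]
  note f_simps = bounded_clinear_add[OF f(1)] bounded_clinear_diff[OF f(1)]
    bounded_clinear_scaleC[OF f(1)] scaleC_complex_def
  note sc_simps = scaleC_add_right scaleC_scaleC complex_vector.scale_right_diff_distrib
  define U where "U x = T x + f x *\<^sub>C y" for x
  have U: "bounded_clinear U"
    unfolding U_def by (intro bounded_clinear_intros bT f)
  have AY: "A w y \<in> Y" for w
    using A_invariant[OF Y y] .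
  have "invertible_op (\<lambda>x. z *\<^sub>C x - U x)" if z: "z \<noteq> 0" for z
  proof -
    define w where "w = inverse z"
    define q where "q = A w y"
    have zw: "z * w = 1" "w * z = 1" using z by (auto simp: w_def)
    have zw': "z *\<^sub>C w *\<^sub>C x = x" "w *\<^sub>C z *\<^sub>C x = x" for x :: 'a
      by (simp_all add: scaleC_scaleC zw)
    have fq: "f q = 0" unfolding q_def by (rule f(2)[OF AY])
    have wTA: "w *\<^sub>C T (A w x) = A w x - x" for x
      using A_right[of w x] by (simp add: algebra_simps)
    \<comment> \<open>Sherman--Morrison: the usual denominator \<open>1 - w * f (A w y)\<close>
      equals 1 because \<open>f q = 0\<close>.\<close>
    define M where "M x = w *\<^sub>C (A w x + (w * f (A w x)) *\<^sub>C q)" for x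
    show ?thesis
    proof (rule invertible_opI)
      show "bounded_clinear (\<lambda>x. z *\<^sub>C x - U x)"
        by (intro bounded_clinear_intros U)
      have "bounded_clinear (\<lambda>x. w *\<^sub>C f (A w x))"
        by (rule bounded_clinear_scaleC_fun[OF bounded_clinear_compose[OF f(1) A]])
      then have "bounded_clinear (\<lambda>x. w * f (A w x))"
        by (simp add: scaleC_complex_def)
      then show "bounded_clinear M"
        unfolding M_def by (intro bounded_clinear_intros A)
      show "z *\<^sub>C M x - U (M x) = x" for x
      proof -
        define c where "c = w * f (A w x)"
        have "T (M x) = w *\<^sub>C T (A w x) + c *\<^sub>C w *\<^sub>C T q"
          by (simp add: M_def c_def T_simps sc_simps mult_ac)
        also have "\<dots> = (A w x - x) + c *\<^sub>C (q - y)"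
          by (simp only: wTA q_def)
        finally have "U (M x) = (A w x - x) + c *\<^sub>C (q - y) + f (M x) *\<^sub>C y"
          by (simp add: U_def)
        moreover have "f (M x) = c"
          by (simp add: M_def c_def f_simps fq)
        moreover have "z *\<^sub>C M x = A w x + c *\<^sub>C q"
          unfolding M_def c_def zw' ..
        ultimately show ?thesis
          by (simp add: sc_simps)
      qed
      show "M (z *\<^sub>C x - U x) = x" for x
      proof -
        have "z *\<^sub>C x - U x = z *\<^sub>C (x - w *\<^sub>C T x) - f x *\<^sub>C y"
          by (simp add: U_def complex_vector.scale_right_diff_distrib scaleC_scaleC zw)
        then have "A w (z *\<^sub>C x - U x) = z *\<^sub>C x - f x *\<^sub>C q"
          by (simp only: bounded_clinear_diff[OF A, where x = "z *\<^sub>C (x - w *\<^sub>C T x)"]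
              bounded_clinear_scaleC[OF A] A_left q_def)
        then show ?thesis
          by (simp add: M_def f_simps fq zw' flip: mult.assoc) (simp add: zw zw')
      qed
    qed
  qed
  moreover have "\<not> invertible_op (\<lambda>x. 0 *\<^sub>C x - U x)"
  proof
    assume "invertible_op (\<lambda>x. 0 *\<^sub>C x - U x)"
    \<comment> \<open>\<open>V\<close> inverts \<open>- U\<close> rather than \<open>U\<close>,
      hence the signs below: \<open>v\<close> is to be the limit of
      \<open>w *\<^sub>C A w y\<close>.\<close>
    then obtain V where V: "bounded_clinear V" "\<And>x. V (- U x) = x" "\<And>x. - U (V x) = x"
      by (rule invertible_opE) auto
    note V_simps = bounded_clinear_add[OF V(1)] bounded_clinear_diff[OF V(1)] bounded_clinear_scaleC[OF V(1)]
    define v where "v = V y"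
    have VU: "V (U x) = - x" for x
      using V(2)[of x] bounded_clinear_diff[OF V(1), of 0 "U x"] bounded_clinear_zero[OF V(1)]
      by (simp add: equation_minus_iff)
    have UV: "U (V x) = - x" for x
      using V(3)[of x] by (metis minus_minus)
    obtain K where K: "K > 0" "\<And>x. norm (V x) \<le> norm x * K"
      using bounded_clinear_pos_bound[OF V(1)] by blast
    \<comment> \<open>\<open>T\<close> and \<open>U\<close> agree at \<open>A w y\<close>, where
      \<open>f\<close> vanishes. Applying \<open>V\<close> to \<open>A w y = y + w U (A w y)\<close>
      gives the identity.\<close>
    have VA: "V (A w y) = v - w *\<^sub>C A w y" for w
    proof -
      have "T (A w y) = U (A w y)" by (simp add: U_def f(2)[OF AY])
      then have "A w y = y + w *\<^sub>C U (A w y)"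
        using A_eq[of w y] by metis
      then have "V (A w y) = V y + w *\<^sub>C V (U (A w y))"
        by (metis bounded_clinear_add[OF V(1)] bounded_clinear_scaleC[OF V(1)])
      then show ?thesis
        by (simp add: VU v_def)
    qed
    have "v \<in> Y"
    proof (rule ccontr)
      assume "v \<notin> Y"
      define d where "d = infdist v Y"
      have d: "d > 0"
        unfolding d_def using infdist_pos_not_in_closed[OF Y(2) _ \<open>v \<notin> Y\<close>] y by blast
      \<comment> \<open>In \<open>w\<close>, the summand \<open>K\<close> absorbs
        \<open>norm (V q) \<le> norm q * K\<close>; the summand \<open>K * norm v / d\<close>
        cancels against the bound \<open>d \<le> norm q * K\<close>; the final \<open>1\<close>
        leaves \<open>d * norm q \<le> 0\<close>, so \<open>q = 0\<close>.\<close>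
      define w where "w = complex_of_real (K + K * norm v / d + 1)"
      define q where "q = A w y"
      have "cmod w = K + K * norm v / d + 1"
        using K(1) d unfolding w_def norm_of_real by (simp add: add_nonneg_nonneg)
      moreover have "cmod w * norm q \<le> norm v + norm (V q)"
        using VA[of w] norm_triangle_ineq4[of v "V q"] by (simp add: q_def norm_scaleC[symmetric])
      ultimately have "(K + K * norm v / d + 1) * norm q \<le> norm v + norm q * K"
        using K(2)[of q] by simp
      then have "(K * norm v / d + 1) * norm q \<le> norm v"
        by (simp add: algebra_simps)
      then have "d * ((K * norm v / d + 1) * norm q) \<le> d * norm v"
        using d by (intro mult_left_mono) auto
      moreover have "d * ((K * norm v / d + 1) * norm q) = K * norm v * norm q + d * norm q"
        using d by (simp add: field_simps)
      ultimately have 1: "K * norm v * norm q + d * norm q \<le> d * norm v"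
        by simp
      \<comment> \<open>\<open>w q\<close> lies in \<open>Y\<close> and differs from
        \<open>v\<close> by \<open>V q\<close>, so \<open>norm (V q)\<close> is at least the
        distance \<open>d\<close>.\<close>
      have "w *\<^sub>C q \<in> Y"
        unfolding q_def using AY Y(1) by (intro complex_vector.subspace_scale)
      then have "d \<le> norm (V q)"
        using infdist_le[of "w *\<^sub>C q" Y v] VA[of w] by (simp add: d_def q_def dist_norm)
      then have 2: "d \<le> norm q * K" using K(2)[of q] by simp
      then have "d * norm v \<le> norm q * K * norm v" by (intro mult_right_mono) auto
      with 1 have "d * norm q \<le> 0" by (simp add: mult_ac)
      with d have "norm q \<le> 0" by (simp add: mult_le_0_iff)
      with 2 d show False by simp
    qed
    then have fv: "f v = 0" by (rule f(2))
    have Tv: "T v = - y"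
      using UV[of y] by (simp add: U_def fv flip: v_def)
    have TU: "T x = U x - f x *\<^sub>C y" for x by (simp add: U_def)
    \<comment> \<open>Sherman--Morrison again, now recovering \<open>- T\<close> from
      \<open>- U\<close>: the denominator is 1 because \<open>f v = 0\<close>.\<close>
    have "invertible_op (\<lambda>x. 0 *\<^sub>C x - T x)"
    proof (rule invertible_opI)
      show "bounded_clinear (\<lambda>x. 0 *\<^sub>C x - T x)"
        by (intro bounded_clinear_intros bT)
      show "bounded_clinear (\<lambda>x. V x - f (V x) *\<^sub>C v)"
        by (intro bounded_clinear_intros V bounded_clinear_compose[OF f(1)])
      show "0 *\<^sub>C (V x - f (V x) *\<^sub>C v) - T (V x - f (V x) *\<^sub>C v) = x" for x
        using TU[of "V x"] by (simp add: T_simps Tv UV)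
      have "V (0 *\<^sub>C x - T x) = x + f x *\<^sub>C v" for x
        by (simp add: TU V_simps VU v_def bounded_clinear_zero[OF V(1)]
            bounded_clinear_diff[OF V(1), of 0, simplified])
      then show "V (0 *\<^sub>C x - T x) - f (V (0 *\<^sub>C x - T x)) *\<^sub>C v = x" for x
        by (simp only: f_simps fv) simp
    qed
    then show False using \<open>0 \<in> op_spectrum T\<close> by (simp add: op_spectrum_def)
  qed
  ultimately have "op_spectrum U = {0}"
    unfolding op_spectrum_def by auto
  then show ?thesis
    using U unfolding quasinilpotent_def U_def by blast
qed

text \<open>Otherwise \<open>A w y\<close>, which is nonzero since \<open>y\<close> is, would be an
  eigenvector of the perturbed operator with nonzero eigenvalue \<open>inverse w\<close>.\<close>

lemma (in entire_fredholm_resolvent) quasinilpotent_perturbation_omits: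
  fixes f :: "'a \<Rightarrow> complex"
  assumes f: "bounded_clinear f" and "y \<noteq> 0" and "quasinilpotent (\<lambda>x. T x + \<beta> *\<^sub>C f x *\<^sub>C y)"
  shows "\<beta> * (w * f (A w y)) \<noteq> 1"
proof
  assume eq: "\<beta> * (w * f (A w y)) = 1"
  define u where "u = A w y"
  have w: "w \<noteq> 0" using eq by auto
  obtain R where R: "bounded_clinear R" "\<And>x. R (inverse w *\<^sub>C x - (T x + \<beta> *\<^sub>C f x *\<^sub>C y)) = x"
    using invertible_opE[OF quasinilpotent_imp_invertible[OF assms(3)]] w
    by (metis inverse_nonzero_iff_nonzero)
  have "inverse w *\<^sub>C (u - w *\<^sub>C T u) = inverse w *\<^sub>C y"
    using A_right[of w y] by (simp only: u_def)
  then have "inverse w *\<^sub>C u - T u = inverse w *\<^sub>C y"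
    using w by (simp add: complex_vector.scale_right_diff_distrib scaleC_scaleC)
  moreover have "\<beta> * f u = inverse w"
    using eq w by (simp add: u_def field_simps)
  ultimately have "inverse w *\<^sub>C u - (T u + \<beta> *\<^sub>C f u *\<^sub>C y) = 0"
    by (simp add: scaleC_scaleC diff_diff_eq[symmetric])
  then have "u = 0"
    using R(2)[of u] bounded_clinear_zero[OF R(1)] by simp
  then show False
    using A_right[of w y] \<open>y \<noteq> 0\<close> bounded_clinear_zero[OF T] by (simp add: u_def)
qed

text \<open>This is the largest \<open>T\<close>-invariant subspace inside the kernel of
  \<open>f\<close>. It is closed as an intersection of kernels, contains \<open>y\<close>, and
  misses \<open>x\<close> by the case \<open>n = 0\<close>.\<close>

lemma invariant_subspace_of_orbit:
  fixes T :: "'a::complex_normed_vector \<Rightarrow> 'a" and f :: "'a \<Rightarrow> complex"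
  assumes T: "bounded_clinear T" and f: "bounded_clinear f" "f x \<noteq> 0"
    and y: "y \<noteq> 0" "\<And>n. f ((T ^^ n) y) = 0"
  shows "invariant_subspace T {x. \<forall>n. f ((T ^^ n) x) = 0}"
proof -
  define Y where "Y = {x. \<forall>n. f ((T ^^ n) x) = 0}"
  have g: "bounded_clinear (\<lambda>x. f ((T ^^ n) x))" for n
    by (rule bounded_clinear_compose[OF f(1) bounded_clinear_funpow[OF T]])
  have "complex_vector.subspace Y"
    unfolding complex_vector.subspace_def Y_def
    by (auto simp: bounded_clinear_zero[OF g] bounded_clinear_add[OF g]
        bounded_clinear_scaleC[OF g] scaleC_complex_def)
  moreover have "closed Y"
    unfolding Y_def
    by (intro closed_Collect_all closed_Collect_eq continuous_on_const
        linear_continuous_on bounded_clinear_imp_bounded_linear g)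
  moreover have "y \<in> Y" using y(2) by (simp add: Y_def)
  moreover have "x \<notin> Y" using f(2) by (auto simp: Y_def intro: exI[of _ 0])
  moreover have "T ` Y \<subseteq> Y"
  proof (intro image_subsetI)
    fix u assume "u \<in> Y"
    then have "f ((T ^^ Suc n) u) = 0" for n by (simp only: Y_def mem_Collect_eq)
    then show "T u \<in> Y" by (simp add: Y_def funpow_swap1)
  qed
  ultimately show ?thesis
    using y(1) unfolding invariant_subspace_def Y_def[symmetric] by blast
qed

theorem theorem2p3:
  fixes T :: "'a::complex_banach \<Rightarrow> 'a"
  assumes "infinite_dimensional TYPE('a)"
    and "separable_space (euclidean :: 'a topology)"
    and "bounded_clinear T"
    and "quasinilpotent T"
  shows "((\<exists>Y. invariant_subspace T Y) \<longleftrightarrow>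
          (\<exists>F. rank_one F \<and> (\<forall>\<alpha>. quasinilpotent (\<lambda>x. T x + \<alpha> *\<^sub>C F x)))) \<and>
         ((\<exists>F. rank_one F \<and> (\<forall>\<alpha>. quasinilpotent (\<lambda>x. T x + \<alpha> *\<^sub>C F x))) \<longleftrightarrow>
          (\<exists>F \<alpha>. rank_one F \<and> \<alpha> \<noteq> 0 \<and> \<alpha> \<noteq> 1 \<and>
             quasinilpotent (\<lambda>x. T x + F x) \<and> quasinilpotent (\<lambda>x. T x + \<alpha> *\<^sub>C F x)))"
    (is "(?P1 \<longleftrightarrow> ?P2) \<and> (?P2 \<longleftrightarrow> ?P3)")
proof -
  have 1: ?P2 if P1: ?P1
  proof -
    obtain Y where Y: "complex_vector.subspace Y" "closed Y" "T ` Y \<subseteq> Y" and "Y \<noteq> {0}" "Y \<noteq> UNIV"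
      using P1 unfolding invariant_subspace_def by blast
    obtain y where y: "y \<in> Y" "y \<noteq> 0"
      using \<open>Y \<noteq> {0}\<close> complex_vector.subspace_0[OF Y(1)] by blast
    obtain a where "a \<notin> Y" using \<open>Y \<noteq> UNIV\<close> by blast
    then obtain f :: "'a \<Rightarrow> complex" where f: "bounded_clinear f" "\<And>x. x \<in> Y \<Longrightarrow> f x = 0" "f a \<noteq> 0"
      using Hahn_Banach_separation[OF Y(1,2)] by metis
    \<comment> \<open>The scalar is absorbed into the vector: \<open>\<alpha> *\<^sub>C y\<close>
      still lies in \<open>Y\<close>.\<close>
    have "quasinilpotent (\<lambda>x. T x + f x *\<^sub>C \<alpha> *\<^sub>C y)" for \<alpha>
      by (rule quasinilpotent_rank_one_perturbation[OF assms(4) Y f(1,2)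
            complex_vector.subspace_scale[OF Y(1) y(1)]])
    then have "quasinilpotent (\<lambda>x. T x + \<alpha> *\<^sub>C f x *\<^sub>C y)" for \<alpha>
      by (simp add: scaleC_scaleC mult.commute)
    moreover have "rank_one (\<lambda>x. f x *\<^sub>C y)"
      using f(1,3) y(2) by (auto simp: rank_one_iff)
    ultimately show ?thesis by blast
  qed
  have 2: ?P3 if P2: ?P2
  proof -
    obtain F where F: "rank_one F" "\<And>\<alpha>. quasinilpotent (\<lambda>x. T x + \<alpha> *\<^sub>C F x)"
      using P2 by blast
    then have "quasinilpotent (\<lambda>x. T x + F x)"
      using F(2)[of 1] by simp
    then show ?thesis
      \<comment> \<open>Any scalar other than 0 and 1 would serve in place of 2.\<close>
      using F by (intro exI[of _ F] exI[of _ 2]) auto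
  qed
  have 3: ?P1 if P3: ?P3
  proof -
    obtain F \<alpha> where F: "rank_one F" and \<alpha>: "\<alpha> \<noteq> 0" "\<alpha> \<noteq> 1"
      and q: "quasinilpotent (\<lambda>x. T x + F x)" "quasinilpotent (\<lambda>x. T x + \<alpha> *\<^sub>C F x)"
      using P3 by blast
    obtain f :: "'a \<Rightarrow> complex" and y x where f: "bounded_clinear f" "f x \<noteq> 0" and y: "y \<noteq> 0"
      and F_eq: "F = (\<lambda>x. f x *\<^sub>C y)"
      using F unfolding rank_one_iff by blast
    obtain A where "entire_fredholm_resolvent T A"
      using quasinilpotent_fredholm_resolvent[OF assms(4)] by blast
    then interpret entire_fredholm_resolvent T A .
    \<comment> \<open>The perturbations with coefficients 1 and \<open>\<alpha>\<close> exclude the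
      values 1 and \<open>1 / \<alpha>\<close>, which differ because
      \<open>\<alpha> \<noteq> 1\<close>.\<close>
    have "w * f (A w y) \<noteq> 1" for w
      using quasinilpotent_perturbation_omits[OF f(1) y, of 1 w] q(1) by (simp add: F_eq)
    moreover have "w * f (A w y) \<noteq> 1 / \<alpha>" for w
      using quasinilpotent_perturbation_omits[OF f(1) y, of \<alpha> w] q(2) \<alpha>(1) by (auto simp: F_eq)
    moreover have "1 \<noteq> 1 / \<alpha>" using \<alpha> by auto
    ultimately have "f ((T ^^ n) y) = 0" for n
      by (intro functional_orbit_eq_zero_of_omits_two_values[OF f(1)])
    then show ?thesis
      using invariant_subspace_of_orbit[OF assms(3) f y] by blast
  qed
  show ?thesis using 1 2 3 by blast
qed

end
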